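(* Let $\mathcal{S}$ be the class of stably strong points in $\mathsf{OrdGrp}$. Then: (1) The Split Short Five Lemma holds with respect to $\mathcal{S}$: given split extensions $X\xrightarrow{k}A\xrightarrow{f}B$ with section $s\colon B\to A$, and $X'\xrightarrow{k'}A'\xrightarrow{f'}B'$ with section $s'\colon B'\to A'$, in $\mathsf{OrdGrp}$, both belonging to $\mathcal{S}$, and morphisms $a\colon X\to X'$, $b\colon A\to A'$, $c\colon B\to B'$ in $\mathsf{OrdGrp}$ such that $b\cdot k=k'\cdot a$, $c\cdot f=f'\cdot b$ and $b\cdot s=s'\cdot c$, if $a$ and $c$ are isomorphisms in $\mathsf{OrdGrp}$, then $b$ is an isomorphism in $\mathsf{OrdGrp}$ as well. (2) For any morphism $h\colon Y\to B$ in $\mathsf{OrdGrp}$, the change of base functor $h^*\colon \mathrm{Pt}_{\mathcal{S}}(B)\to \mathrm{Pt}_{\mathcal{S}}(Y)$ is conservative (reflects isomorphisms).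
   Context: "Order" means preorder (reflexive and transitive, not necessarily antisymmetric). An ordered group is a (not necessarily abelian) group, written additively, with an order $\leq$ for which addition is monotone. $\mathsf{OrdGrp}$ is the category of ordered groups and monotone group homomorphisms. A split extension in $\mathsf{OrdGrp}$ is a sequence $X\xrightarrow{k}A\xrightarrow{f}B$ with $k$ a kernel of $f$ and $f$ a cokernel of $k$, together with a morphism $s\colon B\to A$ such that $f\cdot s=\mathrm{id}_B$; equivalently one speaks of the point $(f,s)$ over $B$ with kernel $k$. (A kernel in $\mathsf{OrdGrp}$ is the group-theoretic kernel with the induced order.) The point $(f,s)$ is strong if $k$ and $s$ are jointly strongly epimorphic, i.e. whenever $k$ and $s$ both factor through a monomorphism $m\colon M\to A$ in $\mathsf{OrdGrp}$, $m$ is an isomorphism in $\mathsf{OrdGrp}$. The pullback of $(f,s)$ along $g\colon C\to B$ is the point over $C$ consisting of the projection $C\times_B A\to C$ and the section $c\mapsto (c,s(g(c)))$, where $C\times_B A$ has the order induced from the product order on $C\times A$. The point is stably strong if its pullback along every morphism $g\colon C\to B$ in $\mathsf{OrdGrp}$ is strong. $\mathrm{Pt}(B)$ is the category of points over $B$; a morphism $(f\colon A\to B,s)\to(f'\colon A'\to B,s')$ is a morphism $t\colon A\to A'$ with $f'\cdot t=f$ and $t\cdot s=s'$. $\mathrm{Pt}_{\mathcal{S}}(B)$ is the full subcategory of points in $\mathcal{S}$. The change of base functor $h^*$ sends a point over $B$ to its pullback along $h\colon Y\to B$, and acts on morphisms by the universal property of pullbacks (stably strong points are pulled back to stably strong points).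 *)

theory Defs
  imports "HOL-Algebra.Coset"
begin

text \<open>Groups are written multiplicatively, following HOL-Algebra, but are not assumed abelian.
  Equality of morphisms always means equality on the carrier of the source.\<close>

record 'a ordgrp = "'a monoid" +
  ordle :: "'a \<Rightarrow> 'a \<Rightarrow> bool" (infixl "\<preceq>\<index>" 50)

locale ordered_group = group G for G :: "('a, 'm) ordgrp_scheme" (structure) +
  assumes ord_refl: "x \<in> carrier G \<Longrightarrow> x \<preceq> x"
    and ord_trans: "\<lbrakk>x \<in> carrier G; y \<in> carrier G; z \<in> carrier G; x \<preceq> y; y \<preceq> z\<rbrakk> \<Longrightarrow> x \<preceq> z"
    and ord_mult: "\<lbrakk>x \<in> carrier G; y \<in> carrier G; x' \<in> carrier G; y' \<in> carrier G; x \<preceq> y; x' \<preceq> y'\<rbrakk>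
      \<Longrightarrow> x \<otimes> x' \<preceq> y \<otimes> y'"

definition ordhom :: "'a ordgrp \<Rightarrow> 'b ordgrp \<Rightarrow> ('a \<Rightarrow> 'b) set" where
  "ordhom G H = {h \<in> hom G H. \<forall>x\<in>carrier G. \<forall>y\<in>carrier G. x \<preceq>\<^bsub>G\<^esub> y \<longrightarrow> h x \<preceq>\<^bsub>H\<^esub> h y}"

definition ord_iso :: "'a ordgrp \<Rightarrow> 'b ordgrp \<Rightarrow> ('a \<Rightarrow> 'b) \<Rightarrow> bool" where
  "ord_iso G H h \<longleftrightarrow> h \<in> ordhom G H \<and>
     (\<exists>i\<in>ordhom H G. (\<forall>x\<in>carrier G. i (h x) = x) \<and> (\<forall>y\<in>carrier H. h (i y) = y))"

text \<open>Test objects are taken on the type of the source. This loses nothing: the inclusion of the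
  kernel of \<open>m\<close> and the trivial map are such tests, so that \<open>ord_mono\<close> implies
  injectivity, and hence cancellation against morphisms from ordered groups on any type.\<close>

definition ord_mono :: "'a ordgrp \<Rightarrow> 'b ordgrp \<Rightarrow> ('a \<Rightarrow> 'b) \<Rightarrow> bool" where
  "ord_mono M A m \<longleftrightarrow> m \<in> ordhom M A \<and>
     (\<forall>(T :: 'a ordgrp) u v. ordered_group T \<and> u \<in> ordhom T M \<and> v \<in> ordhom T M
        \<and> (\<forall>t\<in>carrier T. m (u t) = m (v t)) \<longrightarrow> (\<forall>t\<in>carrier T. u t = v t))"

definition is_kernel :: "'a ordgrp \<Rightarrow> ('a \<Rightarrow> 'a) \<Rightarrow> 'a ordgrp \<Rightarrow> ('a \<Rightarrow> 'b) \<Rightarrow> 'b ordgrp \<Rightarrow> bool" where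
  "is_kernel X k A f B \<longleftrightarrow> k \<in> ordhom X A \<and> (\<forall>x\<in>carrier X. f (k x) = \<one>\<^bsub>B\<^esub>) \<and>
     (\<forall>(T :: 'a ordgrp) g. ordered_group T \<and> g \<in> ordhom T A \<and> (\<forall>t\<in>carrier T. f (g t) = \<one>\<^bsub>B\<^esub>) \<longrightarrow>
        (\<exists>u\<in>ordhom T X. (\<forall>t\<in>carrier T. k (u t) = g t) \<and>
           (\<forall>v\<in>ordhom T X. (\<forall>t\<in>carrier T. k (v t) = g t) \<longrightarrow> (\<forall>t\<in>carrier T. v t = u t))))"

definition is_cokernel :: "'a ordgrp \<Rightarrow> ('a \<Rightarrow> 'b) \<Rightarrow> 'b ordgrp \<Rightarrow> ('b \<Rightarrow> 'b) \<Rightarrow> 'b ordgrp \<Rightarrow> bool" where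
  "is_cokernel X k A f B \<longleftrightarrow> f \<in> ordhom A B \<and> (\<forall>x\<in>carrier X. f (k x) = \<one>\<^bsub>B\<^esub>) \<and>
     (\<forall>(T :: 'b ordgrp) g. ordered_group T \<and> g \<in> ordhom A T \<and> (\<forall>x\<in>carrier X. g (k x) = \<one>\<^bsub>T\<^esub>) \<longrightarrow>
        (\<exists>u\<in>ordhom B T. (\<forall>a\<in>carrier A. u (f a) = g a) \<and>
           (\<forall>v\<in>ordhom B T. (\<forall>a\<in>carrier A. v (f a) = g a) \<longrightarrow> (\<forall>b\<in>carrier B. v b = u b))))"

text \<open>The group-theoretic kernel with the induced order; its inclusion is a kernel in the sense of
  \<open>is_kernel\<close>, see \<open>is_kernel_incl\<close> below.\<close>

definition ker_ord :: "'a ordgrp \<Rightarrow> ('a \<Rightarrow> 'b) \<Rightarrow> 'b ordgrp \<Rightarrow> 'a ordgrp" where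
  "ker_ord A f B = A\<lparr>carrier := kernel A B f\<rparr>"

record ('a, 'b) point =
  Tot :: "'a ordgrp"
  proj :: "'a \<Rightarrow> 'b"
  sect :: "'b \<Rightarrow> 'a"

definition is_point :: "'b ordgrp \<Rightarrow> ('a, 'b) point \<Rightarrow> bool" where
  "is_point B P \<longleftrightarrow> ordered_group B \<and> ordered_group (Tot P) \<and>
     proj P \<in> ordhom (Tot P) B \<and> sect P \<in> ordhom B (Tot P) \<and>
     (\<forall>b\<in>carrier B. proj P (sect P b) = b)"

definition split_extension :: "'a ordgrp \<Rightarrow> ('a \<Rightarrow> 'a) \<Rightarrow> 'a ordgrp \<Rightarrow> ('a, 'a) point \<Rightarrow> bool" where
  "split_extension X k B P \<longleftrightarrow> ordered_group X \<and> is_point B P \<and>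
     is_kernel X k (Tot P) (proj P) B \<and> is_cokernel X k (Tot P) (proj P) B"

text \<open>Since monomorphisms are injective, every subobject of \<open>A\<close> is represented on the type of \<open>A\<close>.\<close>

definition jointly_strongly_epi ::
    "'x ordgrp \<Rightarrow> ('x \<Rightarrow> 'a) \<Rightarrow> 'b ordgrp \<Rightarrow> ('b \<Rightarrow> 'a) \<Rightarrow> 'a ordgrp \<Rightarrow> bool" where
  "jointly_strongly_epi X k B s A \<longleftrightarrow>
     (\<forall>(M :: 'a ordgrp) m. ordered_group M \<and> ord_mono M A m
        \<and> (\<exists>u\<in>ordhom X M. \<forall>x\<in>carrier X. m (u x) = k x)
        \<and> (\<exists>v\<in>ordhom B M. \<forall>b\<in>carrier B. m (v b) = s b)
        \<longrightarrow> ord_iso M A m)"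

definition strong_point :: "'b ordgrp \<Rightarrow> ('a, 'b) point \<Rightarrow> bool" where
  "strong_point B P \<longleftrightarrow> is_point B P \<and>
     jointly_strongly_epi (ker_ord (Tot P) (proj P) B) (\<lambda>x. x) B (sect P) (Tot P)"

definition ord_prod :: "'a ordgrp \<Rightarrow> 'b ordgrp \<Rightarrow> ('a \<times> 'b) ordgrp" where
  "ord_prod G H = \<lparr>carrier = carrier (G \<times>\<times> H), monoid.mult = monoid.mult (G \<times>\<times> H), one = \<one>\<^bsub>G \<times>\<times> H\<^esub>,
     ordle = (\<lambda>(x, y) (x', y'). x \<preceq>\<^bsub>G\<^esub> x' \<and> y \<preceq>\<^bsub>H\<^esub> y')\<rparr>"

definition pullback :: "'c ordgrp \<Rightarrow> ('c \<Rightarrow> 'b) \<Rightarrow> ('a, 'b) point \<Rightarrow> ('c \<times> 'a, 'c) point" where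
  "pullback C g P = \<lparr>
     Tot = (ord_prod C (Tot P))\<lparr>carrier := {(c, a) \<in> carrier C \<times> carrier (Tot P). g c = proj P a}\<rparr>,
     proj = fst,
     sect = (\<lambda>c. (c, sect P (g c)))\<rparr>"

text \<open>The objects \<open>C\<close> range over the ordered groups carried by subsets of the type \<open>'b\<close> of the
  base, which plays the role of the universe. When \<open>'b\<close> is infinite this is the same as letting
  \<open>C\<close> range over all ordered groups whatsoever: strength of the pullback along \<open>g\<close> says that each
  positive \<open>(c, a)\<close> lies in the submonoid, closed under conjugation, generated by the positive
  elements \<open>(1, x)\<close> and \<open>(c', sect P (g c'))\<close>, and if this fails for some \<open>(c, a)\<close>, then it
  already fails for the restriction of \<open>g\<close> to the cyclic subgroup generated by \<open>c\<close>, which is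
  countable.\<close>

definition stably_strong :: "'b ordgrp \<Rightarrow> ('a, 'b) point \<Rightarrow> bool" where
  "stably_strong B P \<longleftrightarrow> is_point B P \<and>
     (\<forall>(C :: 'b ordgrp) g. ordered_group C \<and> g \<in> ordhom C B \<longrightarrow> strong_point C (pullback C g P))"

definition Pt_hom :: "'b ordgrp \<Rightarrow> ('a, 'b) point \<Rightarrow> ('a2, 'b) point \<Rightarrow> ('a \<Rightarrow> 'a2) set" where
  "Pt_hom B P P' = {t \<in> ordhom (Tot P) (Tot P').
     (\<forall>a\<in>carrier (Tot P). proj P' (t a) = proj P a) \<and> (\<forall>b\<in>carrier B. t (sect P b) = sect P' b)}"

text \<open>As \<open>Pt\<^sub>S\<close> is a full subcategory of \<open>Pt\<close>, isomorphisms are the same in both.\<close>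

definition Pt_iso :: "'b ordgrp \<Rightarrow> ('a, 'b) point \<Rightarrow> ('a2, 'b) point \<Rightarrow> ('a \<Rightarrow> 'a2) \<Rightarrow> bool" where
  "Pt_iso B P P' t \<longleftrightarrow> t \<in> Pt_hom B P P' \<and>
     (\<exists>r\<in>Pt_hom B P' P. (\<forall>a\<in>carrier (Tot P). r (t a) = a) \<and> (\<forall>a\<in>carrier (Tot P'). t (r a) = a))"

text \<open>The action of change of base on a morphism of points; \<open>change_of_base_mor_unique\<close> below
  shows that it is the map given by the universal property of the pullback.\<close>

definition change_of_base_mor :: "('a \<Rightarrow> 'a2) \<Rightarrow> 'y \<times> 'a \<Rightarrow> 'y \<times> 'a2" where
  "change_of_base_mor t = (\<lambda>(y, a). (y, t a))"

lemma ordered_group_subgroup: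
  assumes "ordered_group G" "subgroup H G"
  shows "ordered_group (G\<lparr>carrier := H\<rparr>)"
proof -
  interpret ordered_group G by fact
  interpret H: group "G\<lparr>carrier := H\<rparr>" using assms(2) by (rule subgroup_imp_group)
  have "x \<in> H \<Longrightarrow> x \<in> carrier G" for x using subgroup.mem_carrier[OF assms(2)] .
  then show ?thesis
    by unfold_locales (auto intro: ord_refl ord_mult elim: ord_trans[rotated 3])
qed

lemma is_kernel_incl:
  assumes "ordered_group A" "ordered_group B" "f \<in> ordhom A B"
  shows "ordered_group (ker_ord A f B)" "is_kernel (ker_ord A f B) (\<lambda>x. x) A f B"
proof -
  interpret A: ordered_group A by fact
  interpret B: ordered_group B by fact
  interpret group_hom A B f
    using assms(3) by unfold_locales (simp add: ordhom_def)
  show "ordered_group (ker_ord A f B)"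
    unfolding ker_ord_def using assms(1) subgroup_kernel by (rule ordered_group_subgroup)
  show "is_kernel (ker_ord A f B) (\<lambda>x. x) A f B"
    unfolding is_kernel_def
  proof (intro conjI allI impI)
    show "(\<lambda>x. x) \<in> ordhom (ker_ord A f B) A"
      by (auto simp: ordhom_def ker_ord_def kernel_def hom_def)
    show "\<forall>x\<in>carrier (ker_ord A f B). f x = \<one>\<^bsub>B\<^esub>"
      by (simp add: ker_ord_def kernel_def)
  next
    fix T :: "'a ordgrp" and g
    assume "ordered_group T \<and> g \<in> ordhom T A \<and> (\<forall>t\<in>carrier T. f (g t) = \<one>\<^bsub>B\<^esub>)"
    then have "g \<in> ordhom T (ker_ord A f B)"
      by (auto simp: ordhom_def ker_ord_def kernel_def hom_def)
    then show "\<exists>u\<in>ordhom T (ker_ord A f B). (\<forall>t\<in>carrier T. u t = g t) \<and>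
      (\<forall>v\<in>ordhom T (ker_ord A f B). (\<forall>t\<in>carrier T. v t = g t) \<longrightarrow> (\<forall>t\<in>carrier T. v t = u t))"
      by auto
  qed
qed

lemma ordered_group_prod:
  assumes "ordered_group G" "ordered_group H"
  shows "ordered_group (ord_prod G H)"
proof -
  interpret G: ordered_group G by fact
  interpret H: ordered_group H by fact
  interpret P: group "G \<times>\<times> H"
    by (rule DirProd_group) (unfold_locales)
  have "group (ord_prod G H)"
  proof (rule groupI)
    fix x assume "x \<in> carrier (ord_prod G H)"
    then show "\<exists>y\<in>carrier (ord_prod G H). y \<otimes>\<^bsub>ord_prod G H\<^esub> x = \<one>\<^bsub>ord_prod G H\<^esub>"
      using P.l_inv_ex[of x] by (simp add: ord_prod_def)
  qed (auto simp: ord_prod_def DirProd_def G.m_assoc H.m_assoc)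
  then interpret Q: group "ord_prod G H" .
  show ?thesis
    by unfold_locales
      (auto simp: ord_prod_def DirProd_def intro: G.ord_refl H.ord_refl G.ord_mult H.ord_mult
        elim: G.ord_trans[rotated 3] H.ord_trans[rotated 3])
qed

lemma is_point_pullback:
  assumes P: "is_point B P" and C: "ordered_group C" and g: "g \<in> ordhom C B"
  shows "is_point C (pullback C g P)"
proof -
  let ?A = "Tot P"
  let ?S = "{(c, a) \<in> carrier C \<times> carrier ?A. g c = proj P a}"
  interpret C: ordered_group C by fact
  interpret A: ordered_group ?A using P by (simp add: is_point_def)
  interpret B: ordered_group B using P by (simp add: is_point_def)
  interpret f: group_hom ?A B "proj P"
    using P by unfold_locales (simp add: is_point_def ordhom_def)
  interpret s: group_hom B ?A "sect P"
    using P by unfold_locales (simp add: is_point_def ordhom_def)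
  interpret g: group_hom C B g
    using g by unfold_locales (simp add: ordhom_def)
  interpret Q: ordered_group "ord_prod C ?A"
    by (rule ordered_group_prod) unfold_locales
  have "subgroup ?S (ord_prod C ?A)"
  proof (rule Q.subgroupI)
    show "?S \<subseteq> carrier (ord_prod C ?A)" by (auto simp: ord_prod_def)
    have "(\<one>\<^bsub>C\<^esub>, \<one>\<^bsub>?A\<^esub>) \<in> ?S" by simp
    then show "?S \<noteq> {}" by blast
  next
    fix x assume "x \<in> ?S"
    then obtain c a where x: "x = (c, a)" "c \<in> carrier C" "a \<in> carrier ?A" "g c = proj P a" by auto
    have "inv\<^bsub>ord_prod C ?A\<^esub> x = (inv\<^bsub>C\<^esub> c, inv\<^bsub>?A\<^esub> a)"
      by (rule Q.inv_equality) (simp_all add: ord_prod_def DirProd_def x)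
    then show "inv\<^bsub>ord_prod C ?A\<^esub> x \<in> ?S" using x by simp
  next
    fix x y assume "x \<in> ?S" "y \<in> ?S"
    then show "x \<otimes>\<^bsub>ord_prod C ?A\<^esub> y \<in> ?S"
      by (auto simp: ord_prod_def DirProd_def)
  qed
  then have 1: "ordered_group (Tot (pullback C g P))"
    unfolding pullback_def using Q.ordered_group_axioms by (simp add: ordered_group_subgroup)
  show ?thesis
    unfolding is_point_def
  proof (intro conjI)
    show "proj (pullback C g P) \<in> ordhom (Tot (pullback C g P)) C"
      by (auto simp: ordhom_def hom_def pullback_def ord_prod_def DirProd_def)
    show "sect (pullback C g P) \<in> ordhom C (Tot (pullback C g P))"
      using P g by (auto simp: ordhom_def hom_def pullback_def ord_prod_def DirProd_def is_point_def)
  qed (use C 1 in \<open>auto simp: pullback_def\<close>)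
qed

lemma change_of_base_mor_hom:
  assumes h: "h \<in> ordhom Y B" and t: "t \<in> Pt_hom B P P'"
  shows "change_of_base_mor t \<in> Pt_hom Y (pullback Y h P) (pullback Y h P')"
  using assms
  by (auto simp: Pt_hom_def ordhom_def hom_def pullback_def ord_prod_def DirProd_def
      change_of_base_mor_def)

lemma change_of_base_mor_unique:
  assumes "\<And>z. z \<in> carrier (Tot (pullback Y h P)) \<Longrightarrow> fst (w z) = fst z \<and> snd (w z) = t (snd z)"
    and "z \<in> carrier (Tot (pullback Y h P))"
  shows "w z = change_of_base_mor t z"
  using assms by (auto simp: change_of_base_mor_def prod_eq_iff split: prod.splits)

end

theory Submission
  imports Defs
begin

text \<open>Both parts reduce to one observation: the map in question is a monomorphism into the total
  object of a strong point through which the kernel and the section of that point factor, so it is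
  an isomorphism. The factorizations are obtained from the isomorphism on kernels, which in (2) is
  the part of \<open>h\<^sup>*(t)\<close> over the neutral element of \<open>Y\<close>.\<close>

section \<open>Monotone homomorphisms and monomorphisms\<close>

lemma ordhom_closed:
  assumes "h \<in> ordhom G H" "x \<in> carrier G"
  shows "h x \<in> carrier H"
  using assms by (auto simp: ordhom_def hom_def)

lemma ordhom_comp:
  assumes "g \<in> ordhom G H" "h \<in> ordhom H K"
  shows "(\<lambda>x. h (g x)) \<in> ordhom G K"
  using assms by (auto simp: ordhom_def hom_def Pi_iff)

lemma ordhom_one:
  assumes "h \<in> ordhom G H" "ordered_group G" "ordered_group H"
  shows "h \<one>\<^bsub>G\<^esub> = \<one>\<^bsub>H\<^esub>"
  using assms by (auto simp: ordhom_def ordered_group_def intro: hom_one)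

lemma ord_monoI:
  assumes "m \<in> ordhom M A" "inj_on m (carrier M)"
  shows "ord_mono M A m"
  using assms unfolding ord_mono_def by (meson inj_onD ordhom_closed)

lemma ordhom_inj_onI:
  assumes "m \<in> ordhom M A" "ordered_group M" "ordered_group A"
    and ker: "\<And>x. x \<in> carrier M \<Longrightarrow> m x = \<one>\<^bsub>A\<^esub> \<Longrightarrow> x = \<one>\<^bsub>M\<^esub>"
  shows "inj_on m (carrier M)"
proof -
  interpret group_hom M A m
    using assms by (simp add: group_hom_def group_hom_axioms_def ordered_group_def ordhom_def)
  show ?thesis
    using ker by (intro inj_on_one_iff[THEN iffD2]) auto
qed

section \<open>Maps into pullbacks and kernels\<close>

lemma carrier_pullback [simp]:
  "carrier (Tot (pullback C g P)) = {(c, a) \<in> carrier C \<times> carrier (Tot P). g c = proj P a}"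
  by (simp add: pullback_def)

lemma snd_pullback: "snd \<in> ordhom (Tot (pullback C g P)) (Tot P)"
  by (auto simp: ordhom_def hom_def pullback_def ord_prod_def DirProd_def)

text \<open>Existence half of the universal property of the pullback: its order and operation are
  induced from the product, so everything can be checked componentwise.\<close>

lemma ordhom_pullbackI:
  assumes "p \<in> ordhom T C" "q \<in> ordhom T (Tot P)" "\<And>t. t \<in> carrier T \<Longrightarrow> g (p t) = proj P (q t)"
  shows "(\<lambda>t. (p t, q t)) \<in> ordhom T (Tot (pullback C g P))"
  using assms by (auto simp: ordhom_def hom_def pullback_def ord_prod_def DirProd_def Pi_iff)

lemma ordhom_id: "(\<lambda>x. x) \<in> ordhom G G"
  by (simp add: ordhom_def hom_def)

lemma ordhom_triv:
  assumes "ordered_group H"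
  shows "(\<lambda>x. \<one>\<^bsub>H\<^esub>) \<in> ordhom G H"
proof -
  interpret ordered_group H by fact
  show ?thesis by (simp add: ordhom_def hom_def ord_refl)
qed

lemma ker_ord_simps [simp]:
  "carrier (ker_ord A f B) = {x \<in> carrier A. f x = \<one>\<^bsub>B\<^esub>}"
  "\<one>\<^bsub>ker_ord A f B\<^esub> = \<one>\<^bsub>A\<^esub>"
  by (auto simp: ker_ord_def kernel_def)

text \<open>The kernel keeps the operation and the order of \<open>A\<close> and only shrinks the
  carrier, so corestricting a map to it affects neither.\<close>

lemma ordhom_ker_ord:
  "h \<in> ordhom T (ker_ord A f B) \<longleftrightarrow> h \<in> ordhom T A \<and> (\<forall>t\<in>carrier T. f (h t) = \<one>\<^bsub>B\<^esub>)"
  by (auto simp: ordhom_def hom_def ker_ord_def kernel_def)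

lemma ker_ord_incl: "(\<lambda>x. x) \<in> ordhom (ker_ord A f B) A"
  using ordhom_ker_ord[of "\<lambda>x. x"] ordhom_id by blast

section \<open>Recognizing isomorphisms by strength\<close>

text \<open>Strength as a rule, with the two factorizations through \<open>m\<close> given
  explicitly as \<open>u\<close> and \<open>v\<close>.\<close>

lemma strong_point_ord_iso:
  fixes P :: "('a, 'b) point" and M :: "'a ordgrp"
  assumes "strong_point B P" "ordered_group M" "ord_mono M (Tot P) m"
    and "u \<in> ordhom (ker_ord (Tot P) (proj P) B) M"
      "\<And>x. x \<in> carrier (ker_ord (Tot P) (proj P) B) \<Longrightarrow> m (u x) = x"
    and "v \<in> ordhom B M" "\<And>b. b \<in> carrier B \<Longrightarrow> m (v b) = sect P b"
  shows "ord_iso M (Tot P) m"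
  using assms unfolding strong_point_def jointly_strongly_epi_def by blast

text \<open>Strength of \<open>P\<close> itself is strength of its pullback along the identity.\<close>

lemma stably_strong_ord_iso:
  fixes P :: "('a, 'b) point" and M :: "'a ordgrp"
  assumes P: "stably_strong B P" and M: "ordered_group M"
    and m: "m \<in> ordhom M (Tot P)" and inj: "inj_on m (carrier M)"
    and u: "u \<in> ordhom (ker_ord (Tot P) (proj P) B) M"
      "\<And>x. x \<in> carrier (Tot P) \<Longrightarrow> proj P x = \<one>\<^bsub>B\<^esub> \<Longrightarrow> m (u x) = x"
    and v: "v \<in> ordhom B M" "\<And>b. b \<in> carrier B \<Longrightarrow> m (v b) = sect P b"
  shows "ord_iso M (Tot P) m"
proof -
  have pt: "is_point B P" using P by (simp add: stably_strong_def)
  then have B: "ordered_group B" and A: "ordered_group (Tot P)"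
    and f: "proj P \<in> ordhom (Tot P) B" and s: "sect P \<in> ordhom B (Tot P)"
    and fs: "\<And>b. b \<in> carrier B \<Longrightarrow> proj P (sect P b) = b"
    by (auto simp: is_point_def)
  \<comment> \<open>Stable strength speaks of subobjects of a pullback, whose elements are pairs, so
    \<open>M\<close> has to be moved there. Made into a point over \<open>B\<close> with section
    \<open>v\<close>, it has \<open>m\<close> as a morphism of points to \<open>P\<close>, and both
    can be pulled back along the identity.\<close>
  let ?Q = "\<lparr>Tot = M, proj = (\<lambda>x. proj P (m x)), sect = v\<rparr>"
  let ?i = "\<lambda>b. b"
  let ?A' = "pullback B ?i P" and ?M' = "pullback B ?i ?Q"
  let ?K = "ker_ord (Tot ?A') (proj ?A') B"
  let ?n = "change_of_base_mor m"
  have ptQ: "is_point B ?Q"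
    using B M v fs ordhom_comp[OF m f] by (simp add: is_point_def)
  have ptM': "is_point B ?M'" using is_point_pullback[OF ptQ B ordhom_id] .
  have strong: "strong_point B ?A'"
    using P B ordhom_id by (auto simp: stably_strong_def)
  have "m \<in> Pt_hom B ?Q P"
    using m v by (simp add: Pt_hom_def)
  then have n: "?n \<in> Pt_hom B ?M' ?A'" by (rule change_of_base_mor_hom[OF ordhom_id])
  have K: "z \<in> carrier ?K \<longleftrightarrow> fst z = \<one>\<^bsub>B\<^esub> \<and> snd z \<in> carrier (Tot P) \<and> proj P (snd z) = \<one>\<^bsub>B\<^esub>" for z
    using group.is_monoid[OF ordered_group.axioms(1)[OF B]]
    by (auto simp: pullback_def intro: monoid.one_closed)
  \<comment> \<open>An element of \<open>?K\<close> has the form \<open>(\<one>, x)\<close> with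
    \<open>x\<close> in the kernel of \<open>proj P\<close>. Dropping the first component makes
    \<open>u\<close> applicable, and pairing the result with the neutral element lands in
    \<open>?M'\<close>.\<close>
  have "snd \<in> ordhom ?K (ker_ord (Tot P) (proj P) B)"
    unfolding ordhom_ker_ord using ordhom_comp[OF ker_ord_incl snd_pullback] K by auto
  note w = ordhom_comp[OF this u(1)]
  have u': "(\<lambda>z. (\<one>\<^bsub>B\<^esub>, u (snd z))) \<in> ordhom ?K (Tot ?M')"
    by (rule ordhom_pullbackI[OF ordhom_triv[OF B]]) (use w K u(2) in auto)
  have nu: "?n (\<one>\<^bsub>B\<^esub>, u (snd z)) = z" if "z \<in> carrier ?K" for z
    using that K u(2) by (auto simp: change_of_base_mor_def prod_eq_iff)
  have mono: "ord_mono (Tot ?M') (Tot ?A') ?n"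
    by (rule ord_monoI)
      (use n inj in \<open>auto simp: Pt_hom_def inj_on_def change_of_base_mor_def\<close>)
  have M': "ordered_group (Tot ?M')" and v': "sect ?M' \<in> ordhom B (Tot ?M')"
    using ptM' by (auto simp: is_point_def)
  have nv: "?n (sect ?M' b) = sect ?A' b" if "b \<in> carrier B" for b
    using n that by (simp add: Pt_hom_def)
  have "ord_iso (Tot ?M') (Tot ?A') ?n"
    by (rule strong_point_ord_iso[OF strong M' mono u' nu v' nv])
  then obtain i where i: "i \<in> ordhom (Tot ?A') (Tot ?M')"
    "\<And>y. y \<in> carrier (Tot ?A') \<Longrightarrow> ?n (i y) = y"
    unfolding ord_iso_def by blast
  \<comment> \<open>Pulling back along the identity changes \<open>Tot P\<close> only up to the
    isomorphism sending \<open>a\<close> to \<open>(proj P a, a)\<close>; \<open>?j\<close> is the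
    inverse \<open>i\<close> transported along it.\<close>
  let ?j = "\<lambda>a. snd (i (proj P a, a))"
  have "(\<lambda>a. (proj P a, a)) \<in> ordhom (Tot P) (Tot ?A')"
    by (rule ordhom_pullbackI[OF f ordhom_id]) simp
  from ordhom_comp[OF ordhom_comp[OF this i(1)] snd_pullback]
  have j: "?j \<in> ordhom (Tot P) M" by simp
  have mj: "m (?j a) = a" if "a \<in> carrier (Tot P)" for a
    using i(2)[of "(proj P a, a)"] that ordhom_closed[OF f]
    by (auto simp: change_of_base_mor_def split: prod.splits)
  \<comment> \<open>A right inverse of an injective map is also a left inverse.\<close>
  have "?j (m x) = x" if "x \<in> carrier M" for x
  proof -
    have "m x \<in> carrier (Tot P)" using m that by (rule ordhom_closed)
    then have 1: "m (?j (m x)) = m x" and 2: "?j (m x) \<in> carrier M"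
      by (rule mj, rule ordhom_closed[OF j])
    show ?thesis by (rule inj_onD[OF inj 1 2 that])
  qed
  with mj show ?thesis unfolding ord_iso_def by (intro conjI ballI m bexI[OF _ j])
qed

section \<open>The Split Short Five Lemma\<close>

text \<open>Kernels are unique up to isomorphism. This links the arbitrary kernel \<open>k\<close>
  of a split extension with the concrete one in terms of which strength is stated.\<close>

lemma is_kernel_ker_ord:
  fixes X A :: "'a ordgrp"
  assumes "is_kernel X k A f B" "ordered_group X" "ordered_group A" "ordered_group B" "f \<in> ordhom A B"
  shows "\<exists>q\<in>ordhom (ker_ord A f B) X.
    (\<forall>x\<in>carrier (ker_ord A f B). k (q x) = x) \<and> (\<forall>x\<in>carrier X. q (k x) = x)"
proof -
  let ?K = "ker_ord A f B"
  have k: "k \<in> ordhom X A" and fk: "\<forall>x\<in>carrier X. f (k x) = \<one>\<^bsub>B\<^esub>"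
    and ex: "\<And>(T :: 'a ordgrp) g. ordered_group T \<Longrightarrow> g \<in> ordhom T A \<Longrightarrow>
      \<forall>t\<in>carrier T. f (g t) = \<one>\<^bsub>B\<^esub> \<Longrightarrow>
        \<exists>u\<in>ordhom T X. (\<forall>t\<in>carrier T. k (u t) = g t) \<and>
           (\<forall>v\<in>ordhom T X. (\<forall>t\<in>carrier T. k (v t) = g t) \<longrightarrow> (\<forall>t\<in>carrier T. v t = u t))"
    using assms(1) unfolding is_kernel_def by blast+
  obtain q where q: "q \<in> ordhom ?K X" "\<forall>t\<in>carrier ?K. k (q t) = t"
    using ex[OF is_kernel_incl(1)[OF assms(3,4,5)] ker_ord_incl] by auto
  have "k \<in> ordhom X ?K" using k fk by (simp add: ordhom_ker_ord)
  then have qk: "(\<lambda>x. q (k x)) \<in> ordhom X X" using q(1) by (rule ordhom_comp)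
  \<comment> \<open>Both \<open>q\<close> after \<open>k\<close> and the identity of
    \<open>X\<close> factor \<open>k\<close> through itself, so the uniqueness clause identifies
    them.\<close>
  have "\<forall>x\<in>carrier X. k (q (k x)) = k x" using q(2) fk ordhom_closed[OF k] by simp
  then have "\<forall>x\<in>carrier X. q (k x) = x"
    using ex[OF assms(2) k fk] qk ordhom_id[of X] by (metis (no_types, lifting))
  with q show ?thesis by auto
qed

text \<open>An element killed by \<open>b\<close> lies over the neutral element because
  \<open>c\<close> is injective, hence comes from \<open>X\<close>, where \<open>a\<close> is
  injective; so \<open>b\<close> is injective. The inverses of \<open>a\<close> and \<open>c\<close>
  then lift the kernel and the section of \<open>P'\<close> through \<open>b\<close>, and strength
  of \<open>P'\<close> applies.\<close>

lemma split_short_five: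
  fixes X X' :: "'a ordgrp"
  assumes S: "split_extension X k B P" and S': "split_extension X' k' B' P'"
    and P': "stably_strong B' P'"
    and b: "b \<in> ordhom (Tot P) (Tot P')"
    and bk: "\<forall>x\<in>carrier X. b (k x) = k' (a x)"
    and cf: "\<forall>y\<in>carrier (Tot P). c (proj P y) = proj P' (b y)"
    and bs: "\<forall>z\<in>carrier B. b (sect P z) = sect P' (c z)"
    and a: "ord_iso X X' a" and c: "ord_iso B B' c"
  shows "ord_iso (Tot P) (Tot P') b"
proof -
  note bk = bk[rule_format] and cf = cf[rule_format] and bs = bs[rule_format]
  have pt: "is_point B P" "is_point B' P'" and gX: "ordered_group X" "ordered_group X'"
    and ker: "is_kernel X k (Tot P) (proj P) B" "is_kernel X' k' (Tot P') (proj P') B'"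
    using S S' by (auto simp: split_extension_def)
  then have g: "ordered_group B" "ordered_group (Tot P)" "ordered_group B'" "ordered_group (Tot P')"
    and f: "proj P \<in> ordhom (Tot P) B" "proj P' \<in> ordhom (Tot P') B'"
    and s: "sect P \<in> ordhom B (Tot P)" by (auto simp: is_point_def)
  obtain a' where a': "a' \<in> ordhom X' X" "\<forall>x\<in>carrier X. a' (a x) = x" "\<forall>x\<in>carrier X'. a (a' x) = x"
    using a unfolding ord_iso_def by blast
  obtain c' where c': "c' \<in> ordhom B' B" "\<forall>x\<in>carrier B. c' (c x) = x" "\<forall>x\<in>carrier B'. c (c' x) = x"
    using c unfolding ord_iso_def by blast
  have ah: "a \<in> ordhom X X'" and k: "k \<in> ordhom X (Tot P)"
    using a ker(1) by (auto simp: ord_iso_def is_kernel_def)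
  obtain q where "q \<in> ordhom (ker_ord (Tot P) (proj P) B) X"
    "\<forall>x\<in>carrier (ker_ord (Tot P) (proj P) B). k (q x) = x"
    using is_kernel_ker_ord[OF ker(1) gX(1) g(2) g(1) f(1)] by (elim bexE conjE)
  then have q: "q \<in> ordhom (ker_ord (Tot P) (proj P) B) X"
    "\<And>x. x \<in> carrier (Tot P) \<Longrightarrow> proj P x = \<one>\<^bsub>B\<^esub> \<Longrightarrow> k (q x) = x"
    by simp_all
  obtain q' where "q' \<in> ordhom (ker_ord (Tot P') (proj P') B') X'"
    "\<forall>x\<in>carrier (ker_ord (Tot P') (proj P') B'). k' (q' x) = x" "\<forall>x\<in>carrier X'. q' (k' x) = x"
    using is_kernel_ker_ord[OF ker(2) gX(2) g(4) g(3) f(2)] by (elim bexE conjE)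
  then have q': "q' \<in> ordhom (ker_ord (Tot P') (proj P') B') X'"
    "\<And>x. x \<in> carrier (Tot P') \<Longrightarrow> proj P' x = \<one>\<^bsub>B'\<^esub> \<Longrightarrow> k' (q' x) = x"
    "\<And>x. x \<in> carrier X' \<Longrightarrow> q' (k' x) = x"
    by simp_all
  have "y = \<one>\<^bsub>Tot P\<^esub>" if y: "y \<in> carrier (Tot P)" "b y = \<one>\<^bsub>Tot P'\<^esub>" for y
  proof -
    have "c (proj P y) = \<one>\<^bsub>B'\<^esub>" using cf y ordhom_one[OF f(2) g(4,3)] by simp
    then have "proj P y = \<one>\<^bsub>B\<^esub>"
      using bspec[OF c'(2) ordhom_closed[OF f(1) y(1)]] ordhom_one[OF c'(1) g(3,1)] by simp
    then have y': "y \<in> carrier (ker_ord (Tot P) (proj P) B)" and kqy: "k (q y) = y"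
      using y q(2) by auto
    have qy: "q y \<in> carrier X" using ordhom_closed[OF q(1) y'] .
    \<comment> \<open>Since \<open>q'\<close> undoes \<open>k'\<close>, the square
      \<open>b (k x) = k' (a x)\<close> can be solved for \<open>a x\<close>.\<close>
    have "a (q y) = q' (k' (a (q y)))" using q'(3) ordhom_closed[OF ah qy] by simp
    also have "\<dots> = q' \<one>\<^bsub>Tot P'\<^esub>" using bk[OF qy] kqy y(2) by simp
    also have "\<dots> = \<one>\<^bsub>X'\<^esub>"
      using ordhom_one[OF q'(1) is_kernel_incl(1)[OF g(4,3) f(2)] gX(2)] by simp
    finally have "q y = \<one>\<^bsub>X\<^esub>" using bspec[OF a'(2) qy] ordhom_one[OF a'(1) gX(2,1)] by simp
    then show ?thesis using kqy ordhom_one[OF k gX(1) g(2)] by simp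
  qed
  then have inj: "inj_on b (carrier (Tot P))" by (rule ordhom_inj_onI[OF b g(2,4)])
  show ?thesis
  proof (rule stably_strong_ord_iso[OF P' g(2) b inj])
    \<comment> \<open>The lift runs around the kernel square backwards: from the concrete kernel to
      \<open>X'\<close>, by the inverse of \<open>a\<close> to \<open>X\<close>, and by
      \<open>k\<close> into \<open>Tot P\<close>.\<close>
    show "(\<lambda>x. k (a' (q' x))) \<in> ordhom (ker_ord (Tot P') (proj P') B') (Tot P)"
      by (rule ordhom_comp[OF ordhom_comp[OF q'(1) a'(1)] k])
    show "b (k (a' (q' x))) = x" if "x \<in> carrier (Tot P')" "proj P' x = \<one>\<^bsub>B'\<^esub>" for x
    proof -
      have "q' x \<in> carrier X'" using that ordhom_closed[OF q'(1)] by simp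
      then show ?thesis using bk ordhom_closed[OF a'(1)] a'(3) q'(2) that by simp
    qed
    show "(\<lambda>z. sect P (c' z)) \<in> ordhom B' (Tot P)" by (rule ordhom_comp[OF c'(1) s])
    show "b (sect P (c' z)) = sect P' z" if "z \<in> carrier B'" for z
      using bs ordhom_closed[OF c'(1) that] c'(3) that by simp
  qed
qed

section \<open>Change of base reflects isomorphisms\<close>

text \<open>The inverse \<open>r\<close> of the underlying map is automatically a morphism of
  points: compatibility with the projections follows from \<open>t (r a) = a\<close>, and with the
  sections from \<open>r (t x) = x\<close> at \<open>x = sect P b\<close>.\<close>

lemma Pt_isoI:
  assumes P: "is_point B P" and t: "t \<in> Pt_hom B P P'" and iso: "ord_iso (Tot P) (Tot P') t"
  shows "Pt_iso B P P' t"
proof -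
  obtain r where r: "r \<in> ordhom (Tot P') (Tot P)" "\<forall>x\<in>carrier (Tot P). r (t x) = x"
    "\<forall>y\<in>carrier (Tot P'). t (r y) = y"
    using iso unfolding ord_iso_def by blast
  have "proj P (r a) = proj P' a" if "a \<in> carrier (Tot P')" for a
    using t r(3) that ordhom_closed[OF r(1) that] by (auto simp: Pt_hom_def)
  moreover have "r (sect P' b) = sect P b" if "b \<in> carrier B" for b
  proof -
    have "sect P b \<in> carrier (Tot P)" using P that by (auto simp: is_point_def intro: ordhom_closed)
    then show ?thesis using t r(2) that by (auto simp: Pt_hom_def)
  qed
  ultimately show ?thesis using t r unfolding Pt_iso_def Pt_hom_def by blast
qed

text \<open>As \<open>h\<close> preserves the neutral element, the part of each pullback over it is
  a copy of the kernel of the original point. The pulled back isomorphism therefore makes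
  \<open>t\<close> injective and lifts the kernel of \<open>P'\<close> through \<open>t\<close>; the
  section lifts as \<open>sect P\<close>, since \<open>t\<close> is a morphism of points.\<close>

lemma change_of_base_conservative:
  fixes P P' :: "('a, 'b) point"
  assumes Y: "ordered_group Y" and h: "h \<in> ordhom Y B"
    and P: "is_point B P" and P': "stably_strong B P'"
    and t: "t \<in> Pt_hom B P P'"
    and iso: "Pt_iso Y (pullback Y h P) (pullback Y h P') (change_of_base_mor t)"
  shows "Pt_iso B P P' t"
proof -
  have "is_point B P'" using P' by (simp add: stably_strong_def)
  with P have g: "ordered_group B" "ordered_group (Tot P)" "ordered_group (Tot P')"
    and f: "proj P \<in> ordhom (Tot P) B" "proj P' \<in> ordhom (Tot P') B"
    and s: "sect P \<in> ordhom B (Tot P)" by (auto simp: is_point_def)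
  have th: "t \<in> ordhom (Tot P) (Tot P')"
    and ft: "\<And>a. a \<in> carrier (Tot P) \<Longrightarrow> proj P' (t a) = proj P a"
    and ts: "\<And>b. b \<in> carrier B \<Longrightarrow> t (sect P b) = sect P' b"
    using t by (auto simp: Pt_hom_def)
  let ?n = "change_of_base_mor t"
  obtain r where "r \<in> Pt_hom Y (pullback Y h P') (pullback Y h P)"
    and rn: "\<And>z. z \<in> carrier (Tot (pullback Y h P)) \<Longrightarrow> r (?n z) = z"
    and nr: "\<And>z. z \<in> carrier (Tot (pullback Y h P')) \<Longrightarrow> ?n (r z) = z"
    using iso unfolding Pt_iso_def by blast
  then have r: "r \<in> ordhom (Tot (pullback Y h P')) (Tot (pullback Y h P))"
    by (simp add: Pt_hom_def)
  have h1: "h \<one>\<^bsub>Y\<^esub> = \<one>\<^bsub>B\<^esub>" by (rule ordhom_one[OF h Y g(1)])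
  have Y1: "\<one>\<^bsub>Y\<^esub> \<in> carrier Y"
    using Y by (simp add: ordered_group_def group.is_monoid monoid.one_closed)
  have A1: "\<one>\<^bsub>Tot P\<^esub> \<in> carrier (Tot P)"
    using g(2) by (simp add: ordered_group_def group.is_monoid monoid.one_closed)
  have "y = \<one>\<^bsub>Tot P\<^esub>" if y: "y \<in> carrier (Tot P)" "t y = \<one>\<^bsub>Tot P'\<^esub>" for y
  proof -
    \<comment> \<open>Now \<open>y\<close> and the neutral element of \<open>Tot P\<close> both
      occur over the neutral element of \<open>Y\<close>, with equal images under \<open>?n\<close>;
      the left inverse \<open>r\<close> separates such pairs.\<close>
    have "proj P y = \<one>\<^bsub>B\<^esub>" using ft[OF y(1)] y(2) ordhom_one[OF f(2) g(3,1)] by simp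
    then have "r (?n (\<one>\<^bsub>Y\<^esub>, y)) = (\<one>\<^bsub>Y\<^esub>, y)" using rn y h1 Y1 by simp
    moreover have "r (?n (\<one>\<^bsub>Y\<^esub>, \<one>\<^bsub>Tot P\<^esub>)) = (\<one>\<^bsub>Y\<^esub>, \<one>\<^bsub>Tot P\<^esub>)"
      using rn A1 h1 Y1 ordhom_one[OF f(1) g(2,1)] by simp
    ultimately show ?thesis
      using y(2) ordhom_one[OF th g(2,3)] by (simp add: change_of_base_mor_def)
  qed
  then have inj: "inj_on t (carrier (Tot P))" by (rule ordhom_inj_onI[OF th g(2,3)])
  let ?K' = "ker_ord (Tot P') (proj P') B"
  \<comment> \<open>The lift of the kernel of \<open>P'\<close> places \<open>x\<close> over the
    neutral element of \<open>Y\<close>, applies \<open>r\<close> there, and projects to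
    \<open>Tot P\<close>.\<close>
  have "(\<lambda>x. (\<one>\<^bsub>Y\<^esub>, x)) \<in> ordhom ?K' (Tot (pullback Y h P'))"
    by (rule ordhom_pullbackI[OF ordhom_triv[OF Y] ker_ord_incl]) (simp add: h1)
  note u = ordhom_comp[OF ordhom_comp[OF this r] snd_pullback]
  have "t (snd (r (\<one>\<^bsub>Y\<^esub>, x))) = x" if "x \<in> carrier (Tot P')" "proj P' x = \<one>\<^bsub>B\<^esub>" for x
    using nr[of "(\<one>\<^bsub>Y\<^esub>, x)"] that h1 Y1 by (auto simp: change_of_base_mor_def split: prod.splits)
  with u have "ord_iso (Tot P) (Tot P') t"
    using stably_strong_ord_iso[OF P' g(2) th inj _ _ s ts] by blast
  then show ?thesis by (rule Pt_isoI[OF P t])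
qed

theorem theorem4p5:
  shows "(\<forall>(X :: 'u ordgrp) k B P (X' :: 'u ordgrp) k' B' P' a b c.
            split_extension X k B P \<and> stably_strong B P \<and>
            split_extension X' k' B' P' \<and> stably_strong B' P' \<and>
            a \<in> ordhom X X' \<and> b \<in> ordhom (Tot P) (Tot P') \<and> c \<in> ordhom B B' \<and>
            (\<forall>x\<in>carrier X. b (k x) = k' (a x)) \<and>
            (\<forall>y\<in>carrier (Tot P). c (proj P y) = proj P' (b y)) \<and>
            (\<forall>z\<in>carrier B. b (sect P z) = sect P' (c z)) \<and>
            ord_iso X X' a \<and> ord_iso B B' c
            \<longrightarrow> ord_iso (Tot P) (Tot P') b)
       \<and> (\<forall>(Y :: 'u ordgrp) (B :: 'u ordgrp) h.
            ordered_group Y \<and> ordered_group B \<and> h \<in> ordhom Y B \<longrightarrow>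
            (\<forall>(P :: ('u, 'u) point) (P' :: ('u, 'u) point) t.
               stably_strong B P \<and> stably_strong B P' \<and> t \<in> Pt_hom B P P' \<and>
               Pt_iso Y (pullback Y h P) (pullback Y h P') (change_of_base_mor t)
               \<longrightarrow> Pt_iso B P P' t))"
proof (intro conjI allI impI; elim conjE)
  fix X X' B B' :: "'u ordgrp" and k k' a b c and P P' :: "('u, 'u) point"
  assume "split_extension X k B P" "split_extension X' k' B' P'" "stably_strong B' P'"
    "b \<in> ordhom (Tot P) (Tot P')"
    "\<forall>x\<in>carrier X. b (k x) = k' (a x)" "\<forall>y\<in>carrier (Tot P). c (proj P y) = proj P' (b y)"
    "\<forall>z\<in>carrier B. b (sect P z) = sect P' (c z)" "ord_iso X X' a" "ord_iso B B' c"
  then show "ord_iso (Tot P) (Tot P') b" by (rule split_short_five)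
next
  fix Y B :: "'u ordgrp" and h and P P' :: "('u, 'u) point" and t
  assume Y: "ordered_group Y" and h: "h \<in> ordhom Y B"
    and P: "stably_strong B P" and P': "stably_strong B P'" and t: "t \<in> Pt_hom B P P'"
    and iso: "Pt_iso Y (pullback Y h P) (pullback Y h P') (change_of_base_mor t)"
  have "is_point B P" using P by (simp add: stably_strong_def)
  from change_of_base_conservative[OF Y h this P' t iso] show "Pt_iso B P P' t" .
qed

end
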